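(* Let $\beta>0$, $c\in(0,1)$ and $n\ge1$. The roots $x_{1,n}^M<\dots<x_{n,n}^M$ of the Meixner polynomial $M_n(x;\beta,c)$ are real, simple, located in $(0,+\infty)$, have mutual distances greater than $1$, and form the equilibrium distribution of $n$ charges in $(0,+\infty)$, with exclusion radius $h=1$, under the external field $\phi^M$ with force $$F_{\phi^M}(x)=-(\phi^M)'(x)=\frac12\log\left(\frac{c(x+\beta)}{x}\right),\qquad x>0.$$ Moreover, each root $x_{j,n}^M$ increases when the parameter $\beta$ or the parameter $c$ increases.
   Context: Meixner polynomials: $M_n(x;\beta,c)=\sum_{k=0}^n\frac{(-n)_k(-x)_k}{k!\,(\beta)_k}\left(1-\frac1c\right)^k$, where $(u)_k=u(u+1)\cdots(u+k-1)$ is the Pochhammer symbol. For $\beta>0$, $c\in(0,1)$ they are orthogonal with respect to the positive discrete measure $\sum_{j=0}^\infty\frac{(\beta)_jc^j}{j!}\delta_j$, where $\delta_j$ is the Dirac delta at $j$. Equilibrium distribution with $h=1$: the unit-charge potential is $V_x(y)=\frac{x-y}{2}\log\left(\frac{y-x+1}{y-x-1}\right)-\frac12\log\big((y-x+1)(y-x-1)\big)$ for $|y-x|>1$, the energy is $\mathcal{E}_\phi(x_1,\dots,x_n)=\sum_{j\neq k}V_{x_k}(x_j)+2\sum_{j=1}^n\phi(x_j)$, and an equilibrium distribution of $n$ charges in $(s,t)$ is a distribution $x_1<\dots<x_n$ with $x_{j+1}>x_j+1$ that minimizes $\mathcal{E}_\phi$ among all distributions of $n$ points in $(s,t)$ with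 mutual distances greater than $1$. *)

theory Defs
  imports Complex_Main "HOL-Computational_Algebra.Polynomial"
begin

section \<open>Meixner polynomials\<close>

text \<open>Since \<open>[:0, -1:]\<close> is the polynomial \<open>-x\<close>, its rising factorial in the polynomial ring is
  \<open>(-x)\<^sub>k\<close>. The coefficient field is left generic so that the same polynomial can be considered over
  the reals and over the complex numbers.\<close>

definition meixner :: "nat \<Rightarrow> 'a::field_char_0 \<Rightarrow> 'a \<Rightarrow> 'a poly" where
  "meixner n \<beta> c =
     (\<Sum>k\<le>n. smult (pochhammer (- of_nat n) k / (fact k * pochhammer \<beta> k) * (1 - 1 / c) ^ k)
                  (pochhammer [:0, -1:] k))"

lemma poly_meixner:
  "poly (meixner n \<beta> c) x =
     (\<Sum>k\<le>n. pochhammer (- of_nat n) k * pochhammer (- x) k / (fact k * pochhammer \<beta> k)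
              * (1 - 1 / c) ^ k)"
proof -
  have "poly (pochhammer [:0, -1:] k) x = pochhammer (- x) k" for k
    by (simp add: pochhammer_prod poly_prod)
  then show ?thesis
    by (simp add: meixner_def poly_sum mult_ac)
qed

text \<open>The \<open>j\<close>-th real zero in increasing order, with \<open>j\<close> counted from 1.\<close>

definition meixner_root :: "nat \<Rightarrow> real \<Rightarrow> real \<Rightarrow> nat \<Rightarrow> real" where
  "meixner_root n \<beta> c j = sorted_list_of_set {x. poly (meixner n \<beta> c) x = 0} ! (j - 1)"

section \<open>Equilibrium distributions with exclusion radius 1\<close>

text \<open>The potential at \<open>y\<close> of a unit charge at \<open>x\<close>; it is meaningful only for \<open>\<bar>y - x\<bar> > 1\<close>.\<close>

definition charge_potential :: "real \<Rightarrow> real \<Rightarrow> real" where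
  "charge_potential x y =
     (x - y) / 2 * ln ((y - x + 1) / (y - x - 1)) - 1 / 2 * ln ((y - x + 1) * (y - x - 1))"

text \<open>Distributions of \<open>n\<close> charges are functions of which only the values on \<open>{1..n}\<close> matter.
  The interaction sum runs over ordered pairs.\<close>

definition energy :: "nat \<Rightarrow> (real \<Rightarrow> real) \<Rightarrow> (nat \<Rightarrow> real) \<Rightarrow> real" where
  "energy n \<phi> x =
     (\<Sum>(j, k) \<in> {(j, k). j \<in> {1..n} \<and> k \<in> {1..n} \<and> j \<noteq> k}. charge_potential (x k) (x j))
     + 2 * (\<Sum>j = 1..n. \<phi> (x j))"

definition admissible :: "nat \<Rightarrow> real set \<Rightarrow> (nat \<Rightarrow> real) \<Rightarrow> bool" where
  "admissible n S x \<longleftrightarrow>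
     (\<forall>j\<in>{1..n}. x j \<in> S) \<and> (\<forall>j\<in>{1..n}. \<forall>k\<in>{1..n}. j \<noteq> k \<longrightarrow> \<bar>x j - x k\<bar> > 1)"

definition equilibrium :: "nat \<Rightarrow> real set \<Rightarrow> (real \<Rightarrow> real) \<Rightarrow> (nat \<Rightarrow> real) \<Rightarrow> bool" where
  "equilibrium n S \<phi> x \<longleftrightarrow>
     admissible n S x \<and> (\<forall>j\<in>{1..<n}. x (Suc j) > x j + 1) \<and>
     (\<forall>y. admissible n S y \<longrightarrow> energy n \<phi> x \<le> energy n \<phi> y)"

definition meixner_force :: "real \<Rightarrow> real \<Rightarrow> real \<Rightarrow> real" where
  "meixner_force \<beta> c x = 1 / 2 * ln (c * (x + \<beta>) / x)"

text \<open>A force determines the external field only up to an additive constant, which is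
  irrelevant for the minimization of the energy.\<close>

definition field_with_force :: "real set \<Rightarrow> (real \<Rightarrow> real) \<Rightarrow> (real \<Rightarrow> real) \<Rightarrow> bool" where
  "field_with_force S F \<phi> \<longleftrightarrow> (\<forall>x\<in>S. (\<phi> has_real_derivative - F x) (at x))"

lemma meixner_field_exists:
  assumes "\<beta> > 0" "0 < c"
  shows "\<exists>\<phi>. field_with_force {0<..} (meixner_force \<beta> c) \<phi>"
proof -
  define \<phi> where "\<phi> x = - (x * ln c + (x + \<beta>) * ln (x + \<beta>) - x * ln x) / 2" for x
  have "(\<phi> has_real_derivative - meixner_force \<beta> c x) (at x)" if "x > 0" for x
  proof -
    have eq: "meixner_force \<beta> c x = (ln c + ln (x + \<beta>) - ln x) / 2"
      using assms that by (simp add: meixner_force_def ln_div ln_mult)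
    show ?thesis unfolding \<phi>_def eq
      by (rule derivative_eq_intros refl | use assms that in \<open>simp add: field_simps\<close>)+
  qed
  then show ?thesis by (auto simp: field_with_force_def)
qed

end

theory Submission
  imports Defs
begin

text \<open>The forward and backward shift relations express \<open>M\<^sub>n(x; \<beta>, c)\<close> through
  \<open>M\<^bsub>n-1\<^esub>(x; \<beta> + 1, c)\<close>. By induction on \<open>n\<close> for all \<open>\<beta>\<close>, sign changes in the backward relation
  locate \<open>n\<close> positive zeros with gaps greater than 1. Together the two relations give
  \<open>c (x + \<beta>) M\<^sub>n(x + 1) + x M\<^sub>n(x - 1) = 0\<close> at the zeros, whose logarithm is the balance of forces.
  On increasingly ordered distributions the energy is convex, since pair potential and external
  field lie above their tangents, so a balanced distribution is the unique minimizer.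
  Monotonicity in the parameters is a discrete maximum principle for the balance of forces.\<close>

section \<open>Forward and backward shift relations\<close>

text \<open>The forward difference in x sends (-x)_(k+1) to -(k+1) (-x)_k. The other Pochhammer
  symbols split off their first factor, so term k+1 of the sum becomes a multiple of term k of the
  shifted sum; the constant terms cancel.\<close>

lemma meixner_forward_shift:
  fixes x \<beta> c :: real
  assumes "\<beta> > 0"
  shows "poly (meixner (Suc m) \<beta> c) (x + 1) - poly (meixner (Suc m) \<beta> c) x
           = real (Suc m) * (1 - 1 / c) / \<beta> * poly (meixner m (\<beta> + 1) c) x"
proof -
  define z where "z = 1 - 1 / c"
  have pos: "pochhammer (\<beta> + 1) k > 0" for k
    using assms by (intro pochhammer_pos) simp
  have "pochhammer (- real (Suc m)) (Suc k) * pochhammer (- (x + 1)) (Suc k)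
            / (fact (Suc k) * pochhammer \<beta> (Suc k)) * z ^ Suc k
        - pochhammer (- real (Suc m)) (Suc k) * pochhammer (- x) (Suc k)
            / (fact (Suc k) * pochhammer \<beta> (Suc k)) * z ^ Suc k
        = real (Suc m) * z / \<beta> * (pochhammer (- real m) k * pochhammer (- x) k
            / (fact k * pochhammer (\<beta> + 1) k) * z ^ k)" for k
  proof -
    have n: "pochhammer (- real (Suc m)) (Suc k) = - real (Suc m) * pochhammer (- real m) k"
      by (simp add: pochhammer_rec)
    have b: "pochhammer \<beta> (Suc k) = \<beta> * pochhammer (\<beta> + 1) k"
      by (simp add: pochhammer_rec)
    have x: "pochhammer (- (x + 1)) (Suc k) - pochhammer (- x) (Suc k)
               = - real (Suc k) * pochhammer (- x) k"
      unfolding pochhammer_rec[of "- (x + 1)"] pochhammer_Suc[of "- x"] by (simp add: algebra_simps)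
    have "pochhammer (- real (Suc m)) (Suc k) * pochhammer (- (x + 1)) (Suc k)
            / (fact (Suc k) * pochhammer \<beta> (Suc k)) * z ^ Suc k
        - pochhammer (- real (Suc m)) (Suc k) * pochhammer (- x) (Suc k)
            / (fact (Suc k) * pochhammer \<beta> (Suc k)) * z ^ Suc k
        = pochhammer (- real (Suc m)) (Suc k)
            * (pochhammer (- (x + 1)) (Suc k) - pochhammer (- x) (Suc k))
            / (fact (Suc k) * pochhammer \<beta> (Suc k)) * z ^ Suc k"
      by (simp add: diff_divide_distrib right_diff_distrib left_diff_distrib)
    also have "\<dots> = real (Suc m) * z / \<beta> * (pochhammer (- real m) k * pochhammer (- x) k
            / (fact k * pochhammer (\<beta> + 1) k) * z ^ k)"
      unfolding n b x using pos[of k] assms by (simp add: divide_simps del: of_nat_Suc)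
    finally show ?thesis .
  qed
  then show ?thesis
    unfolding poly_meixner sum_subtractf[symmetric] sum_distrib_left z_def[symmetric]
    by (subst sum.atMost_Suc_shift) simp
qed

text \<open>Coefficients are compared in the basis (-x)_k. The right side returns to this basis
  through x (-x)_k = k (-x)_k - (-x)_(k+1) and x (1-x)_k = -(-x)_(k+1).\<close>

lemma meixner_backward_shift:
  fixes x \<beta> c :: real
  assumes "\<beta> > 0" "c \<noteq> 0"
  shows "c * \<beta> * poly (meixner (Suc m) \<beta> c) x
           = c * (x + \<beta>) * poly (meixner m (\<beta> + 1) c) x - x * poly (meixner m (\<beta> + 1) c) (x - 1)"
proof -
  define z where "z = 1 - 1 / c"
  define a where "a k = pochhammer (- real m) k / (fact k * pochhammer (\<beta> + 1) k) * z ^ k" for k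
  define b where "b k = pochhammer (- real (Suc m)) k / (fact k * pochhammer \<beta> k) * z ^ k" for k
  define P where "P k = pochhammer (- x) k" for k
  have c: "1 - c = - c * z"
    using assms by (simp add: z_def field_simps)
  \<comment> \<open>Comparison of the coefficients of (-x)_(k+1). The factor k+1 clears the new
    factor of the factorial and makes every term a multiple of \<open>A\<close>; since 1 - c = -c z,
    what remains is (k - m) - (k + 1) = -(m + 1).\<close>
  have rec: "c * \<beta> * b (Suc k) = c * (\<beta> + real (Suc k)) * a (Suc k) + (1 - c) * a k" for k
  proof -
    have pos: "pochhammer (\<beta> + 1) k > 0" "\<beta> + real (Suc k) > 0"
      using assms by (auto intro!: pochhammer_pos)
    have n: "pochhammer (- real (Suc m)) (Suc k) = - real (Suc m) * pochhammer (- real m) k"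
      by (simp add: pochhammer_rec)
    have be: "pochhammer \<beta> (Suc k) = \<beta> * pochhammer (\<beta> + 1) k"
      by (simp add: pochhammer_rec)
    have be': "pochhammer (\<beta> + 1) (Suc k) = pochhammer (\<beta> + 1) k * (\<beta> + real (Suc k))"
      by (simp add: pochhammer_Suc algebra_simps)
    have m: "pochhammer (- real m) (Suc k) = pochhammer (- real m) k * (real k - real m)"
      by (simp add: pochhammer_Suc)
    define A where "A = pochhammer (- real m) k * z ^ k / (fact k * pochhammer (\<beta> + 1) k)"
    have a0: "a k = A" by (simp add: a_def A_def)
    have a1: "real (Suc k) * ((\<beta> + real (Suc k)) * a (Suc k)) = (real k - real m) * z * A"
      unfolding a_def A_def be' m using pos by (simp add: divide_simps del: of_nat_Suc)
    have b1: "real (Suc k) * (\<beta> * b (Suc k)) = - real (Suc m) * z * A"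
      unfolding b_def A_def be n using pos assms by (simp add: divide_simps del: of_nat_Suc)
    have "real (Suc k) * (c * \<beta> * b (Suc k)) = c * (real (Suc k) * (\<beta> * b (Suc k)))" by simp
    also have "\<dots> = c * (real (Suc k) * ((\<beta> + real (Suc k)) * a (Suc k)))
                   + real (Suc k) * ((1 - c) * a k)"
      unfolding a0 a1 b1 c by (simp add: algebra_simps)
    also have "\<dots> = real (Suc k) * (c * (\<beta> + real (Suc k)) * a (Suc k) + (1 - c) * a k)"
      by (simp add: algebra_simps)
    finally show ?thesis by (simp del: of_nat_Suc)
  qed
  have q: "poly (meixner m (\<beta> + 1) c) x = (\<Sum>k\<le>m. a k * P k)"
    unfolding poly_meixner a_def P_def z_def by (intro sum.cong) auto
  have q': "x * poly (meixner m (\<beta> + 1) c) (x - 1) = - (\<Sum>k\<le>m. a k * P (Suc k))"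
    unfolding poly_meixner a_def P_def z_def sum_distrib_left sum_negf[symmetric]
    by (intro sum.cong refl) (simp add: pochhammer_rec)
  have p: "poly (meixner (Suc m) \<beta> c) x = (\<Sum>k\<le>Suc m. b k * P k)"
    unfolding poly_meixner b_def P_def z_def by (intro sum.cong) auto
  \<comment> \<open>The vanishing of (-m)_(m+1) allows the sum to be extended to
    \<open>Suc m\<close>, after which its index can be shifted.\<close>
  have am: "a (Suc m) = 0"
    by (simp add: a_def pochhammer_of_nat_eq_0_iff)
  have "c * (x + \<beta>) * (a k * P k) = c * (\<beta> + real k) * a k * P k - c * (a k * P (Suc k))" for k
    by (simp add: P_def pochhammer_Suc algebra_simps)
  then have "c * (x + \<beta>) * (\<Sum>k\<le>m. a k * P k)
      = (\<Sum>k\<le>m. c * (\<beta> + real k) * a k * P k) - c * (\<Sum>k\<le>m. a k * P (Suc k))"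
    unfolding sum_distrib_left sum_subtractf[symmetric]
    by (intro sum.cong refl)
  also have "(\<Sum>k\<le>m. c * (\<beta> + real k) * a k * P k)
             = (\<Sum>k\<le>Suc m. c * (\<beta> + real k) * a k * P k)"
    using am by simp
  also have "\<dots> = c * \<beta> + (\<Sum>k\<le>m. c * (\<beta> + real (Suc k)) * a (Suc k) * P (Suc k))"
    by (subst sum.atMost_Suc_shift) (simp add: a_def P_def)
  finally have "c * (x + \<beta>) * poly (meixner m (\<beta> + 1) c) x - x * poly (meixner m (\<beta> + 1) c) (x - 1)
    = c * \<beta> + (\<Sum>k\<le>m. (c * (\<beta> + real (Suc k)) * a (Suc k) + (1 - c) * a k) * P (Suc k))"
    unfolding q q' by (simp add: sum.distrib sum_distrib_left sum_subtractf algebra_simps)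
  also have "\<dots> = c * \<beta> * poly (meixner (Suc m) \<beta> c) x"
    unfolding p rec[symmetric]
    by (subst sum.atMost_Suc_shift) (simp add: b_def P_def sum_distrib_left algebra_simps)
  finally show ?thesis by simp
qed

section \<open>Leading coefficient and factorization over distinct zeros\<close>

lemma degree_pochhammer_linear:
  "degree (pochhammer [:0, -1 :: 'a :: field_char_0:] k) = k"
  "coeff (pochhammer [:0, -1 :: 'a:] k) k = (-1) ^ k"
proof -
  have f: "[:0, -1:] + of_nat i = [:of_nat i, -1 :: 'a:]" for i
    by (simp add: of_nat_poly)
  have "pochhammer [:0, -1 :: 'a:] k = (\<Prod>i<k. [:of_nat i, -1:])"
    by (simp add: pochhammer_prod f atLeast0LessThan)
  moreover have "degree (\<Prod>i<k. [:of_nat i, -1 :: 'a:]) = k"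
    by (subst degree_prod_eq_sum_degree) auto
  moreover have "lead_coeff (\<Prod>i<k. [:of_nat i, -1 :: 'a:]) = (-1) ^ k"
    by (subst lead_coeff_prod) simp
  ultimately show "degree (pochhammer [:0, -1 :: 'a:] k) = k"
    "coeff (pochhammer [:0, -1 :: 'a:] k) k = (-1) ^ k" by auto
qed

lemma degree_meixner_le: "degree (meixner n \<beta> c) \<le> n"
  unfolding meixner_def
  by (intro degree_sum_le) (auto intro!: order_trans[OF degree_smult_le] simp: degree_pochhammer_linear)

text \<open>Only the summand k = n reaches degree n, and there (-n)_n = (-1)^n n! cancels both the
  factorial and the sign of the leading coefficient of (-x)_n.\<close>

lemma coeff_meixner:
  "coeff (meixner n \<beta> c) n = (1 - 1 / c) ^ n / pochhammer \<beta> n"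
proof -
  have "coeff (meixner n \<beta> c) n = (\<Sum>k\<le>n. if k = n then
      pochhammer (- of_nat n) k / (fact k * pochhammer \<beta> k) * (1 - 1 / c) ^ k * (-1) ^ k else 0)"
    unfolding meixner_def coeff_sum coeff_smult
    by (intro sum.cong refl) (auto simp: degree_pochhammer_linear intro: coeff_eq_0)
  also have "\<dots> = (1 - 1 / c) ^ n / pochhammer \<beta> n"
    by (simp add: pochhammer_same power_mult_distrib[symmetric])
  finally show ?thesis .
qed

text \<open>This normalization later fixes the sign of the factorization in
  \<open>poly_meixner_eq_prod\<close>.\<close>

lemma poly_meixner_0: "poly (meixner n \<beta> c) 0 = 1"
  by (simp add: poly_meixner pochhammer_0_left if_distrib if_distribR cong: if_cong)

lemma coeff_meixner_neq_0:
  fixes \<beta> c :: real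
  assumes "\<beta> > 0" "0 < c" "c < 1"
  shows "coeff (meixner n \<beta> c) n \<noteq> 0"
proof -
  have "pochhammer \<beta> n \<noteq> 0"
    using assms pochhammer_pos[of \<beta> n] by auto
  then show ?thesis using assms by (simp add: coeff_meixner)
qed

text \<open>Both sides have degree at most \<open>card I\<close>, share the coefficient at that
  index and agree at \<open>card I\<close> points. Taking that coefficient instead of the leading
  one means that an upper bound on the degree suffices.\<close>

lemma poly_eq_prod_roots:
  fixes p :: "'a :: idom poly" and r :: "'b \<Rightarrow> 'a"
  assumes "degree p \<le> card I" "inj_on r I" "finite I" "\<And>k. k \<in> I \<Longrightarrow> poly p (r k) = 0"
  shows "p = smult (coeff p (card I)) (\<Prod>k\<in>I. [:- r k, 1:])"
proof (rule poly_eqI_degree_lead_coeff[where A = "r ` I" and n = "card I"])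
  have d: "degree (\<Prod>k\<in>I. [:- r k, 1:]) = card I"
    by (subst degree_prod_eq_sum_degree) auto
  show "degree (smult (coeff p (card I)) (\<Prod>k\<in>I. [:- r k, 1:])) \<le> card I"
    using degree_smult_le[of _ "\<Prod>k\<in>I. [:- r k, 1:]"] d by metis
  have "lead_coeff (\<Prod>k\<in>I. [:- r k, 1:]) = 1"
    by (subst lead_coeff_prod) simp
  then show "coeff p (card I) = coeff (smult (coeff p (card I)) (\<Prod>k\<in>I. [:- r k, 1:])) (card I)"
    by (simp add: d)
  show "card I \<le> card (r ` I)" using assms by (simp add: card_image)
  show "poly p z = poly (smult (coeff p (card I)) (\<Prod>k\<in>I. [:- r k, 1:])) z" if "z \<in> r ` I" for z
  proof -
    have "(\<Prod>k\<in>I. z - r k) = 0" using that assms by (auto intro!: prod_zero)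
    then show ?thesis using that assms by (auto simp: poly_prod)
  qed
qed (use assms in auto)

section \<open>Separated configurations and location of the zeros\<close>

text \<open>Unlike \<open>admissible\<close>, this fixes the order of the charges. Corresponding
  differences of two separated configurations then lie on the same branch, d > 1 or d < -1, of the
  pair force.\<close>

definition separated :: "nat \<Rightarrow> (nat \<Rightarrow> real) \<Rightarrow> bool" where
  "separated n x \<longleftrightarrow> (\<forall>j\<in>{1..n}. \<forall>k\<in>{1..n}. j < k \<longrightarrow> x j + 1 < x k)"

lemma separatedI:
  assumes "\<And>j. 1 \<le> j \<Longrightarrow> j < n \<Longrightarrow> x j + 1 < x (Suc j)"
  shows "separated n x"
proof -
  have "x j + 1 < x k" if "1 \<le> j" "j < k" "k \<le> n" for j k
    using that(2,1,3)
  proof (induction rule: strict_inc_induct)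
    case (base i)
    then show ?case using assms[of i] by simp
  next
    case (step i)
    then show ?case using assms[of i] by simp
  qed
  then show ?thesis by (auto simp: separated_def)
qed

lemma separated_inj: "separated n x \<Longrightarrow> inj_on x {1..n}"
  unfolding separated_def by (intro linorder_inj_onI) force+

lemma separated_dist:
  "separated n x \<Longrightarrow> j \<in> {1..n} \<Longrightarrow> k \<in> {1..n} \<Longrightarrow> j \<noteq> k \<Longrightarrow> \<bar>x j - x k\<bar> > 1"
  unfolding separated_def by (cases j k rule: linorder_cases) fastforce+

text \<open>Exactly the first \<open>i\<close> factors are negative.\<close>

lemma sign_prod_below:
  fixes x :: "nat \<Rightarrow> real"
  assumes "i \<le> n" "\<And>k. 1 \<le> k \<Longrightarrow> k \<le> i \<Longrightarrow> x k < t" "\<And>k. i < k \<Longrightarrow> k \<le> n \<Longrightarrow> t < x k"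
  shows "(-1) ^ i * (\<Prod>k\<in>{1..n}. x k - t) > 0"
proof -
  have "{1..n} = {1..i} \<union> {i<..n}" using assms by auto
  then have "(\<Prod>k\<in>{1..n}. x k - t) = (\<Prod>k\<in>{1..i}. x k - t) * (\<Prod>k\<in>{i<..n}. x k - t)"
    by (simp add: prod.union_disjoint Int_def)
  also have "(\<Prod>k\<in>{1..i}. x k - t) = (\<Prod>k\<in>{1..i}. - 1 * (t - x k))" by simp
  also have "\<dots> = (-1) ^ i * (\<Prod>k\<in>{1..i}. t - x k)"
    by (simp only: prod.distrib prod_constant card_atLeastAtMost) simp
  finally have "(-1) ^ i * (\<Prod>k\<in>{1..n}. x k - t)
      = (\<Prod>k\<in>{1..i}. t - x k) * (\<Prod>k\<in>{i<..n}. x k - t)"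
    by (simp add: power_mult_distrib[symmetric])
  also have "\<dots> > 0" using assms by (intro mult_pos_pos prod_pos) auto
  finally show ?thesis .
qed

text \<open>With factors \<open>x k - t\<close> the product is positive at t = 0, where the
  polynomial equals 1; hence the constant is positive.\<close>

lemma poly_meixner_eq_prod:
  fixes \<beta> c :: real
  assumes "\<beta> > 0" "0 < c" "c < 1" "separated n x"
    and "\<And>j. j \<in> {1..n} \<Longrightarrow> 0 < x j \<and> poly (meixner n \<beta> c) (x j) = 0"
  obtains b where "b > 0" "\<And>t. poly (meixner n \<beta> c) t = b * (\<Prod>k\<in>{1..n}. x k - t)"
proof -
  define a where "a = coeff (meixner n \<beta> c) n"
  have "meixner n \<beta> c = smult (coeff (meixner n \<beta> c) (card {1..n})) (\<Prod>k\<in>{1..n}. [:- x k, 1:])"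
    using assms by (intro poly_eq_prod_roots) (auto simp: degree_meixner_le separated_inj simp del: One_nat_def)
  then have eq: "meixner n \<beta> c = smult a (\<Prod>k\<in>{1..n}. [:- x k, 1:])"
    by (simp add: a_def)
  have "poly (meixner n \<beta> c) t = (-1) ^ n * a * (\<Prod>k\<in>{1..n}. x k - t)" for t
  proof -
    have "(\<Prod>k\<in>{1..n}. t - x k) = (\<Prod>k\<in>{1..n}. - 1 * (x k - t))" by simp
    also have "\<dots> = (-1) ^ n * (\<Prod>k\<in>{1..n}. x k - t)"
      by (simp only: prod.distrib prod_constant card_atLeastAtMost) simp
    finally show ?thesis by (subst eq) (simp add: poly_prod)
  qed
  moreover have "(-1) ^ n * a > 0"
  proof (rule zero_less_mult_pos2)
    have "(-1) ^ n * a * (\<Prod>k\<in>{1..n}. x k) = 1"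
      using calculation[of 0] by (simp add: poly_meixner_0)
    then show "(-1) ^ n * a * (\<Prod>k\<in>{1..n}. x k) > 0" by simp
    show "(\<Prod>k\<in>{1..n}. x k) > 0" using assms by (intro prod_pos) auto
  qed
  ultimately show ?thesis by (intro that)
qed

text \<open>Since 1 - 1/c < 0, the leading coefficient has sign (-1)^n. This supplies the sign
  change on the unbounded interval to the right of all the others.\<close>

lemma meixner_sign_at_top:
  fixes \<beta> c :: real
  assumes "\<beta> > 0" "0 < c" "c < 1"
  shows "\<exists>t>s. (-1) ^ n * poly (meixner n \<beta> c) t > 0"
proof -
  define p where "p = smult ((-1) ^ n) (meixner n \<beta> c)"
  have nz: "coeff (meixner n \<beta> c) n \<noteq> 0" using assms by (rule coeff_meixner_neq_0)
  then have deg: "degree (meixner n \<beta> c) = n"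
    using degree_meixner_le[of n \<beta> c] by (meson le_antisym le_degree)
  have "lead_coeff p = ((-1) * (1 - 1 / c)) ^ n / pochhammer \<beta> n"
    by (simp add: p_def deg coeff_meixner power_mult_distrib[symmetric])
  also have "\<dots> > 0"
    using assms by (intro divide_pos_pos zero_less_power pochhammer_pos) (auto simp: field_simps)
  finally obtain N where "\<forall>t\<ge>N. poly p t \<ge> lead_coeff p" and "lead_coeff p > 0"
    using poly_pinfty_gt_lc by blast
  then have "poly p (max N (s + 1)) > 0" by (meson less_le_trans max.cobounded1)
  then show ?thesis by (intro exI[of _ "max N (s + 1)"]) (auto simp: p_def)
qed

text \<open>Let \<open>y\<^sub>1 < \<dots> < y\<^sub>m\<close> be the zeros for \<open>m\<close> and \<open>\<beta> + 1\<close>. By the backward shift, the next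
  polynomial changes sign on each of \<open>(0, y\<^sub>1)\<close>, \<open>(y\<^sub>i + 1, y\<^bsub>i+1\<^esub>)\<close> and \<open>(y\<^sub>m + 1, \<infinity>)\<close>,
  and any two of these intervals are more than 1 apart.\<close>
lemma meixner_separated_zeros:
  fixes \<beta> c :: real
  assumes "\<beta> > 0" "0 < c" "c < 1"
  shows "\<exists>x. separated n x \<and> (\<forall>j\<in>{1..n}. 0 < x j \<and> poly (meixner n \<beta> c) (x j) = 0)"
  using assms(1)
proof (induction n arbitrary: \<beta>)
  case 0
  then show ?case by (simp add: separated_def)
next
  case (Suc m)
  from Suc.IH[of "\<beta> + 1"] Suc.prems obtain y where sep: "separated m y"
    and y: "\<And>j. j \<in> {1..m} \<Longrightarrow> 0 < y j \<and> poly (meixner m (\<beta> + 1) c) (y j) = 0" by auto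
  define p where "p = meixner (Suc m) \<beta> c"
  define q where "q = meixner m (\<beta> + 1) c"
  obtain b where b: "b > 0" and q_prod: "\<And>t. poly q t = b * (\<Prod>k\<in>{1..m}. y k - t)"
    using poly_meixner_eq_prod[OF _ assms(2,3) sep y] Suc.prems by (auto simp: q_def)
  have gap: "y j + 1 < y k" if "1 \<le> j" "j < k" "k \<le> m" for j k
    using sep that by (auto simp: separated_def)
  have mono: "y j \<le> y k" if "1 \<le> j" "j \<le> k" "k \<le> m" for j k
    using gap[of j k] that by (cases "j = k") auto
  have q_sign: "(-1) ^ i * poly q t > 0"
    if "i \<le> m" "i \<ge> 1 \<Longrightarrow> y i < t" "i < m \<Longrightarrow> t < y (Suc i)" for i t
  proof -
    have "(-1) ^ i * (\<Prod>k\<in>{1..m}. y k - t) > 0"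
    proof (rule sign_prod_below)
      show "y k < t" if "1 \<le> k" "k \<le> i" for k
        using mono[of k i] that \<open>i \<le> m\<close> \<open>i \<ge> 1 \<Longrightarrow> y i < t\<close> by simp
      show "t < y k" if "i < k" "k \<le> m" for k
        using mono[of "Suc i" k] that \<open>i < m \<Longrightarrow> t < y (Suc i)\<close> by simp
    qed fact
    then have "b * ((-1) ^ i * (\<Prod>k\<in>{1..m}. y k - t)) > 0" using b by simp
    then show ?thesis by (simp add: q_prod mult_ac)
  qed
  have shift: "c * \<beta> * poly p t = c * (t + \<beta>) * poly q t - t * poly q (t - 1)" for t
    unfolding p_def q_def using Suc.prems assms by (intro meixner_backward_shift) auto
  have cb: "c * \<beta> > 0" using Suc.prems assms by simp
  \<comment> \<open>The left ends of the intervals are the points where the term t q(t - 1) of the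
    backward shift vanishes, by t = 0 or by q(y_i) = 0. There \<open>p\<close> has the sign of
    \<open>q\<close>, namely (-1)^i.\<close>
  define lo where "lo i = (if i = 0 then 0 else y i + 1)" for i
  have lo_pos: "lo i \<ge> 0" if "i \<le> m" for i
    using y[of i] that by (auto simp: lo_def)
  have lo: "(-1) ^ i * poly p (lo i) > 0" if "i \<le> m" for i
  proof -
    have "lo i * poly q (lo i - 1) = 0" using y[of i] that by (auto simp: lo_def q_def)
    then have "c * \<beta> * poly p (lo i) = c * (lo i + \<beta>) * poly q (lo i)"
      using shift[of "lo i"] by linarith
    from arg_cong[OF this, of "\<lambda>s. (-1) ^ i * s"]
    have "c * \<beta> * ((-1) ^ i * poly p (lo i)) = c * (lo i + \<beta>) * ((-1) ^ i * poly q (lo i))"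
      by (simp only: mult_ac)
    also have "\<dots> > 0"
    proof (rule mult_pos_pos)
      show "c * (lo i + \<beta>) > 0"
        using lo_pos[OF that] Suc.prems assms by (intro mult_pos_pos) auto
      show "(-1) ^ i * poly q (lo i) > 0"
        using gap[of i "Suc i"] y[of 1] that by (intro q_sign) (auto simp: lo_def)
    qed
    finally show ?thesis using cb by (rule zero_less_mult_pos)
  qed
  \<comment> \<open>At t = y_(i+1) the other term vanishes. The gap keeps t - 1 above y_i, so q(t -
    1) has sign (-1)^i and its minus sign reverses that of \<open>p\<close>. For i = m the sign at
    infinity is used.\<close>
  have hi: "\<exists>t>lo i. (i < m \<longrightarrow> t \<le> y (Suc i)) \<and> (-1) ^ i * poly p t < 0" if "i \<le> m" for i
  proof (cases "i = m")
    case True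
    then show ?thesis
      using meixner_sign_at_top[OF Suc.prems assms(2,3), of "lo i" "Suc m"] by (auto simp: p_def)
  next
    case False
    let ?t = "y (Suc i)"
    have t: "lo i < ?t" "?t > 0"
      using gap[of i "Suc i"] y[of "Suc i"] that False by (auto simp: lo_def)
    have "poly q ?t = 0" using y[of "Suc i"] that False by (simp add: q_def)
    then have "c * \<beta> * poly p ?t = - (?t * poly q (?t - 1))"
      using shift[of ?t] by simp
    from arg_cong[OF this, of "\<lambda>s. (-1) ^ i * s"]
    have "c * \<beta> * ((-1) ^ i * poly p ?t) = - (?t * ((-1) ^ i * poly q (?t - 1)))"
      by (simp only: mult_ac mult_minus_right)
    also have "\<dots> < 0"
    proof -
      have "(-1) ^ i * poly q (?t - 1) > 0"
        using gap[of i "Suc i"] that False by (intro q_sign) auto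
      with t(2) have "?t * ((-1) ^ i * poly q (?t - 1)) > 0" by (rule mult_pos_pos)
      then show ?thesis by simp
    qed
    finally have "c * \<beta> * ((-1) ^ i * poly p ?t) < c * \<beta> * 0" by simp
    then have "(-1) ^ i * poly p ?t < 0" using cb by (simp only: mult_less_cancel_left_pos)
    then show ?thesis using t by auto
  qed
  have "\<exists>s>lo i. (i < m \<longrightarrow> s < y (Suc i)) \<and> poly p s = 0" if "i \<le> m" for i
  proof -
    from hi[OF that] obtain t where t: "t > lo i" "i < m \<longrightarrow> t \<le> y (Suc i)" "(-1) ^ i * poly p t < 0"
      by auto
    have "poly (smult ((-1) ^ i) p) (lo i) > 0" "poly (smult ((-1) ^ i) p) t < 0"
      using lo[OF that] t by auto
    then obtain s where "lo i < s" "s < t" "poly (smult ((-1) ^ i) p) s = 0"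
      using poly_IVT_neg[OF t(1)] by blast
    then show ?thesis using t by (intro exI[of _ s]) auto
  qed
  then obtain s where s: "\<And>i. i \<le> m \<Longrightarrow> lo i < s i \<and> (i < m \<longrightarrow> s i < y (Suc i)) \<and> poly p (s i) = 0"
    by metis
  \<comment> \<open>Intervals are counted from 0 and zeros from 1. The zero \<open>x j\<close> lies
    below \<open>y j\<close>, and the next one above \<open>y j + 1\<close>.\<close>
  define x where "x j = s (j - 1)" for j
  have "separated (Suc m) x"
  proof (rule separatedI)
    fix j assume j: "1 \<le> j" "j < Suc m"
    then have "x j < y j" using s[of "j - 1"] by (simp add: x_def)
    moreover have "y j + 1 < x (Suc j)" using s[of j] j by (simp add: x_def lo_def)
    ultimately show "x j + 1 < x (Suc j)" by simp
  qed
  moreover have "0 < x j \<and> poly p (x j) = 0" if "j \<in> {1..Suc m}" for j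
  proof -
    have "j - 1 \<le> m" using that by auto
    then show ?thesis using s[of "j - 1"] lo_pos[of "j - 1"] by (simp add: x_def)
  qed
  ultimately show ?case by (auto simp: p_def)
qed

section \<open>Sorted enumeration of the real zeros and simplicity over the complex numbers\<close>

lemma nth_sorted_list_of_strict_mono:
  fixes x :: "nat \<Rightarrow> real"
  assumes "strict_mono_on {1..n} x" "j \<in> {1..n}"
  shows "sorted_list_of_set (x ` {1..n}) ! (j - 1) = x j"
proof -
  have "sorted_list_of_set (x ` {1..n}) = map x [1..<Suc n]"
  proof (rule strict_sorted_equal)
    show "sorted_wrt (<) (map x [1..<Suc n])"
      using assms(1) by (auto simp: sorted_wrt_iff_nth_less strict_mono_on_def simp del: upt_Suc)
  qed auto
  then show ?thesis using assms(2) by (auto simp del: upt_Suc)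
qed

lemma separated_strict_mono: "separated n x \<Longrightarrow> strict_mono_on {1..n} x"
  unfolding separated_def strict_mono_on_def by force

lemma meixner_zero_set:
  fixes \<beta> c :: real
  assumes "\<beta> > 0" "0 < c" "c < 1" "separated n x"
    and "\<And>j. j \<in> {1..n} \<Longrightarrow> 0 < x j \<and> poly (meixner n \<beta> c) (x j) = 0"
  shows "{t. poly (meixner n \<beta> c) t = 0} = x ` {1..n}"
proof -
  obtain b where "b > 0" "\<And>t. poly (meixner n \<beta> c) t = b * (\<Prod>k\<in>{1..n}. x k - t)"
    using poly_meixner_eq_prod[OF assms] by blast
  then show ?thesis by (auto simp: image_iff)
qed

text \<open>The n zeros found above exhaust the zero set by the factorization, so the sorted
  enumeration returns them in order.\<close>

lemma meixner_root_properties: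
  fixes \<beta> c :: real
  assumes "\<beta> > 0" "0 < c" "c < 1"
  shows separated_meixner_root: "separated n (meixner_root n \<beta> c)"
    and meixner_root_zero: "j \<in> {1..n} \<Longrightarrow> 0 < meixner_root n \<beta> c j \<and>
            poly (meixner n \<beta> c) (meixner_root n \<beta> c j) = 0"
proof -
  from meixner_separated_zeros[OF assms, of n] obtain x where x: "separated n x"
    "\<And>j. j \<in> {1..n} \<Longrightarrow> 0 < x j \<and> poly (meixner n \<beta> c) (x j) = 0" by blast
  have zeros: "{t. poly (meixner n \<beta> c) t = 0} = x ` {1..n}"
    using x by (intro meixner_zero_set[OF assms])
  have root: "meixner_root n \<beta> c j = x j" if "j \<in> {1..n}" for j
    unfolding meixner_root_def zeros
    using that separated_strict_mono[OF x(1)] by (intro nth_sorted_list_of_strict_mono)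
  show "separated n (meixner_root n \<beta> c)" using x(1) root by (simp add: separated_def)
  show "j \<in> {1..n} \<Longrightarrow> 0 < meixner_root n \<beta> c j \<and> poly (meixner n \<beta> c) (meixner_root n \<beta> c j) = 0"
    using x(2) root by simp
qed

text \<open>The complex polynomial extends the real one, so the n distinct real zeros already split
  it into linear factors. This leaves no other zeros and makes each one simple.\<close>

lemma meixner_complex_zeros:
  fixes \<beta> c :: real
  assumes "\<beta> > 0" "0 < c" "c < 1"
  shows "{z :: complex. poly (meixner n (of_real \<beta>) (of_real c)) z = 0}
           = of_real ` meixner_root n \<beta> c ` {1..n}" (is "_ = ?R")
    and "poly (meixner n (of_real \<beta>) (of_real c)) (z :: complex) = 0 \<Longrightarrow>
           order z (meixner n (of_real \<beta>) (of_real c)) = 1"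
proof -
  define p where "p = meixner n (complex_of_real \<beta>) (of_real c)"
  define r where "r j = complex_of_real (meixner_root n \<beta> c j)" for j
  have pc: "poly p (of_real t) = of_real (poly (meixner n \<beta> c) t)" for t
    by (simp add: p_def poly_meixner flip: pochhammer_of_real)
  have "coeff p n = of_real (coeff (meixner n \<beta> c) n)"
    by (simp add: p_def coeff_meixner pochhammer_of_real)
  then have nz: "coeff p n \<noteq> 0" using coeff_meixner_neq_0[OF assms] by simp
  have inj: "inj_on r {1..n}"
    using separated_inj[OF separated_meixner_root[OF assms, of n]]
    unfolding r_def inj_on_def of_real_eq_iff .
  have "p = smult (coeff p (card {1..n})) (\<Prod>k\<in>{1..n}. [:- r k, 1:])"
  proof (rule poly_eq_prod_roots)
    show "degree p \<le> card {1..n}" by (simp add: p_def degree_meixner_le)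
    show "poly p (r k) = 0" if "k \<in> {1..n}" for k
      using meixner_root_zero[OF assms that] by (simp add: r_def pc)
  qed (use inj in simp_all)
  then have eq: "p = smult (coeff p n) (\<Prod>k\<in>{1..n}. [:- r k, 1:])" by simp
  have "poly p z = coeff p n * (\<Prod>k\<in>{1..n}. z - r k)" for z
    by (subst eq) (simp add: poly_prod)
  then have zeros: "poly p z = 0 \<longleftrightarrow> z \<in> r ` {1..n}" for z
    using nz by auto
  then have "{z. poly p z = 0} = r ` {1..n}" by blast
  then show "{z. poly (meixner n (of_real \<beta>) (of_real c)) z = 0} = ?R"
    unfolding p_def r_def image_image .
  assume "poly (meixner n (of_real \<beta>) (of_real c)) z = 0"
  then have "z \<in> r ` {1..n}" using zeros by (simp only: p_def)
  then obtain j where j: "j \<in> {1..n}" "z = r j" by blast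
  have proots: "proots p = (\<Sum>k\<in>{1..n}. {#r k#})"
    by (subst eq) (simp add: nz proots_prod)
  have "count (proots p) z = (\<Sum>k\<in>{1..n}. if r k = z then 1 else 0)"
    unfolding proots count_sum by (intro sum.cong) simp_all
  also have "\<dots> = (\<Sum>k\<in>{1..n}. if k = j then 1 else 0)"
    using inj_on_eq_iff[OF inj _ j(1)] j(2) by (intro sum.cong) simp_all
  also have "\<dots> = 1" using j(1) by simp
  finally have "count (proots p) z = 1" .
  moreover have "p \<noteq> 0" using nz by auto
  ultimately show "order z (meixner n (of_real \<beta>) (of_real c)) = 1"
    by (simp flip: p_def)
qed

section \<open>Forces, their balance at the zeros, and monotonicity in the parameters\<close>

text \<open>For d > 1 this is minus the derivative of \<open>charge_potential 0\<close> at d: the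
  force of a unit charge on another one at signed offset d.\<close>

definition pair_force :: "real \<Rightarrow> real" where
  "pair_force d = 1 / 2 * ln ((d + 1) / (d - 1))"

text \<open>On separated configurations in the domain of the field this is the critical point
  equation of the energy, up to the factor -2.\<close>

definition balanced :: "nat \<Rightarrow> (real \<Rightarrow> real) \<Rightarrow> (nat \<Rightarrow> real) \<Rightarrow> bool" where
  "balanced n F x \<longleftrightarrow> (\<forall>j\<in>{1..n}. (\<Sum>k\<in>{1..n}-{j}. pair_force (x j - x k)) + F (x j) = 0)"

lemma pair_force_uminus:
  assumes "\<bar>d\<bar> > 1"
  shows "pair_force (- d) = - pair_force d"
proof -
  have eq: "(- d + 1) / (- d - 1) = inverse ((d + 1) / (d - 1))"
    using assms by (simp add: field_simps)
  show ?thesis unfolding pair_force_def eq by (simp only: ln_inverse mult_minus_right)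
qed

text \<open>The ratio (d + 1)/(d - 1) = 1 + 2/(d - 1) is positive and decreasing on each of the two
  branches.\<close>

lemma pair_force_less:
  assumes "d < e" "1 < d \<or> e < -1"
  shows "pair_force e < pair_force d"
proof -
  have "(e + 1) / (e - 1) < (d + 1) / (d - 1)" "0 < (e + 1) / (e - 1)" "0 < (d + 1) / (d - 1)"
    using assms by (auto simp: field_simps zero_less_divide_iff)
  then show ?thesis by (simp add: pair_force_def)
qed

text \<open>The argument of the logarithm is c (1 + \<beta>/x). Varying position and parameters
  together serves both the convexity of the field and the comparison of roots.\<close>

lemma meixner_force_less:
  assumes "0 < \<beta>" "\<beta> \<le> \<beta>'" "0 < c" "c \<le> c'" "0 < y" "y \<le> x" "\<beta> < \<beta>' \<or> c < c' \<or> y < x"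
  shows "meixner_force \<beta> c x < meixner_force \<beta>' c' y"
proof -
  define u v where "u = \<beta> / x" and "v = \<beta>' / y"
  have u: "0 < u" and le: "u \<le> v" using assms by (auto simp: u_def v_def intro: frac_le)
  have "c * (1 + u) < c' * (1 + v)"
  proof (cases "c < c'")
    case True
    then show ?thesis using le u assms by (intro mult_less_le_imp_less) auto
  next
    case False
    then have "u < v"
      unfolding u_def v_def using assms by (cases "y < x") (auto intro!: frac_less2 divide_strict_right_mono)
    then show ?thesis using u assms by (intro mult_le_less_imp_less) auto
  qed
  moreover have "c * (1 + u) = c * (x + \<beta>) / x" "c' * (1 + v) = c' * (y + \<beta>') / y"
    using assms by (auto simp: u_def v_def field_simps)
  moreover have "c * (1 + u) > 0" using u assms by simp
  ultimately show ?thesis by (simp add: meixner_force_def)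
qed

text \<open>Eliminating the shifted polynomial \<open>q\<close> between the two relations at a zero
  x_j gives c (x_j + \<beta>) P(1) = x_j P(-1), and P(1)/P(-1) is the product of the ratios inside
  the pair forces.\<close>

lemma meixner_root_balanced:
  assumes "\<beta> > 0" "0 < c" "c < 1"
  shows "balanced n (meixner_force \<beta> c) (meixner_root n \<beta> c)"
  unfolding balanced_def
proof
  fix j assume j: "j \<in> {1..n}"
  define x where "x = meixner_root n \<beta> c"
  define I where "I = {1..n} - {j}"
  define q where "q = meixner (n - 1) (\<beta> + 1) c"
  define K where "K = real n * (1 - 1 / c) / \<beta>"
  note sep = separated_meixner_root[OF assms, of n]
  have zero: "0 < x i" "poly (meixner n \<beta> c) (x i) = 0" if "i \<in> {1..n}" for i
    using meixner_root_zero[OF assms that] by (auto simp: x_def)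
  have dist: "\<bar>x j - x k\<bar> > 1" if "k \<in> I" for k
    using separated_dist[OF sep, of j k] j that by (auto simp: x_def I_def)
  obtain b where b: "b > 0" "\<And>t. poly (meixner n \<beta> c) t = b * (\<Prod>k\<in>{1..n}. x k - t)"
    using poly_meixner_eq_prod[OF assms sep meixner_root_zero[OF assms]] by (auto simp: x_def)
  have prod: "poly (meixner n \<beta> c) t = b * ((x j - t) * (\<Prod>k\<in>I. x k - t))" for t
    unfolding b(2) I_def using j by (subst prod.remove[of _ j]) auto
  have n: "n = Suc (n - 1)" using j by simp
  have fw: "poly (meixner n \<beta> c) (t + 1) - poly (meixner n \<beta> c) t = K * poly q t" for t
    using meixner_forward_shift[of \<beta> "n - 1" c t] assms n by (simp add: K_def q_def)
  have bw: "c * (x j + \<beta>) * poly q (x j) = x j * poly q (x j - 1)"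
    using meixner_backward_shift[of \<beta> c "n - 1" "x j"] assms n zero(2)[OF j] by (simp add: q_def)
  \<comment> \<open>The value of the polynomial at x_j + s is \<open>b * (- s) * P s\<close>: the
    factor of the zero x_j itself is split off.\<close>
  define P where "P s = (\<Prod>k\<in>I. x k - (x j + s))" for s
  have "K * poly q (x j) = - b * P 1"
    using fw[of "x j"] zero(2)[OF j] by (simp add: prod P_def)
  moreover have "K * poly q (x j - 1) = - b * P (- 1)"
    using fw[of "x j - 1"] zero(2)[OF j] by (simp add: prod P_def)
  \<comment> \<open>Multiplication by \<open>K\<close> brings the backward relation into the form in
    which the two preceding equations can be substituted.\<close>
  moreover have "c * (x j + \<beta>) * (K * poly q (x j)) = x j * (K * poly q (x j - 1))"
    using arg_cong[OF bw, of "\<lambda>t. K * t"] by (simp only: mult_ac)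
  ultimately have "b * (c * (x j + \<beta>) * P 1) = b * (x j * P (- 1))"
    by (simp add: algebra_simps)
  then have eq: "c * (x j + \<beta>) * P 1 = x j * P (- 1)"
    using b(1) by simp
  have pos: "(x j - x k + 1) / (x j - x k - 1) > 0" if "k \<in> I" for k
    using dist[OF that] by (auto simp: zero_less_divide_iff)
  have nz: "P (- 1) \<noteq> 0"
    using dist by (force simp: I_def P_def)
  have "(\<Prod>k\<in>I. (x j - x k + 1) / (x j - x k - 1)) = (\<Prod>k\<in>I. (x k - (x j + 1)) / (x k - (x j - 1)))"
  proof (rule prod.cong)
    fix k assume "k \<in> I"
    have "(x j - x k + 1) / (x j - x k - 1) = - (x j - x k + 1) / - (x j - x k - 1)"
      by (simp only: minus_divide_divide)
    then show "(x j - x k + 1) / (x j - x k - 1) = (x k - (x j + 1)) / (x k - (x j - 1))"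
      by (simp add: algebra_simps)
  qed simp
  also have "\<dots> = inverse (c * (x j + \<beta>) / x j)"
  proof -
    define C where "C = c * (x j + \<beta>)"
    have "C > 0" using zero(1)[OF j] assms by (simp add: C_def)
    moreover have "C * P 1 = x j * P (- 1)" using eq by (simp add: C_def)
    ultimately have "P 1 / P (- 1) = inverse (C / x j)"
      using nz zero(1)[OF j] by (simp add: divide_simps mult_ac)
    then show ?thesis by (simp add: P_def C_def prod_dividef)
  qed
  finally have P: "(\<Prod>k\<in>I. (x j - x k + 1) / (x j - x k - 1)) = inverse (c * (x j + \<beta>) / x j)" .
  have "(\<Sum>k\<in>I. pair_force (x j - x k)) = 1 / 2 * ln (\<Prod>k\<in>I. (x j - x k + 1) / (x j - x k - 1))"
    unfolding pair_force_def sum_distrib_left[symmetric]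
    by (subst ln_prod) (simp add: I_def, metis pos less_irrefl, simp)
  also have "\<dots> = - meixner_force \<beta> c (x j)"
    unfolding P meixner_force_def by (simp only: ln_inverse mult_minus_right)
  finally show "(\<Sum>k\<in>{1..n}-{j}. pair_force (meixner_root n \<beta> c j - meixner_root n \<beta> c k))
      + meixner_force \<beta> c (meixner_root n \<beta> c j) = 0"
    by (simp add: x_def I_def)
qed

text \<open>A discrete maximum principle: at an index where \<open>x j - y j\<close> is maximal, every difference
  \<open>y j - y k\<close> is at most \<open>x j - x k\<close>, so the repulsion on \<open>y j\<close> is at least that on \<open>x j\<close>.\<close>
lemma balanced_less:
  assumes x: "separated n x" "balanced n F x" and y: "separated n y" "balanced n G y"
    and less: "\<And>j. j \<in> {1..n} \<Longrightarrow> y j \<le> x j \<Longrightarrow> F (x j) < G (y j)"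
    and i: "i \<in> {1..n}"
  shows "x i < y i"
proof (rule ccontr)
  assume not_less: "\<not> x i < y i"
  have "Max ((\<lambda>j. x j - y j) ` {1..n}) \<in> (\<lambda>j. x j - y j) ` {1..n}"
    using i by (intro Max_in) auto
  then obtain j where j: "j \<in> {1..n}" "Max ((\<lambda>j. x j - y j) ` {1..n}) = x j - y j" by auto
  have max: "x k - y k \<le> x j - y j" if "k \<in> {1..n}" for k
    using that by (auto simp: j(2)[symmetric])
  have "pair_force (x j - x k) \<le> pair_force (y j - y k)" if "k \<in> {1..n} - {j}" for k
  proof -
    \<comment> \<open>By maximality the y-difference is at most the x-difference, so either
      alternative puts both on one branch of the pair force.\<close>
    have "1 < y j - y k \<or> x j - x k < -1"
    proof (cases "j < k")
      case True
      then have "x j + 1 < x k" using x(1) j(1) that by (simp add: separated_def)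
      then show ?thesis by simp
    next
      case False
      then have "y k + 1 < y j" using y(1) j(1) that by (simp add: separated_def)
      then show ?thesis by simp
    qed
    then show ?thesis
      using pair_force_less[of "y j - y k" "x j - x k"] max[of k] that
      by (cases "y j - y k = x j - x k") auto
  qed
  then have "(\<Sum>k\<in>{1..n}-{j}. pair_force (x j - x k)) \<le> (\<Sum>k\<in>{1..n}-{j}. pair_force (y j - y k))"
    by (rule sum_mono)
  \<comment> \<open>The maximum is at least \<open>x i - y i\<close>, which is nonnegative by the
    assumption to be refuted.\<close>
  moreover have "F (x j) < G (y j)" using less[OF j(1)] max[OF i] not_less by simp
  moreover have "(\<Sum>k\<in>{1..n}-{j}. pair_force (x j - x k)) + F (x j) = 0"
    "(\<Sum>k\<in>{1..n}-{j}. pair_force (y j - y k)) + G (y j) = 0"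
    using x(2) y(2) j(1) unfolding balanced_def by blast+
  ultimately show False by linarith
qed

text \<open>The force decreases with position and increases with either parameter, which is the
  comparison required by \<open>balanced_less\<close>.\<close>

lemma meixner_root_less:
  assumes "0 < \<beta>" "\<beta> \<le> \<beta>'" "0 < c" "c \<le> c'" "c' < 1" "\<beta> < \<beta>' \<or> c < c'" "j \<in> {1..n}"
  shows "meixner_root n \<beta> c j < meixner_root n \<beta>' c' j"
proof (rule balanced_less)
  have "0 < \<beta>'" "0 < c'" "c < 1" using assms by auto
  then show "separated n (meixner_root n \<beta> c)" "separated n (meixner_root n \<beta>' c')"
    "balanced n (meixner_force \<beta> c) (meixner_root n \<beta> c)"
    "balanced n (meixner_force \<beta>' c') (meixner_root n \<beta>' c')"
    using assms by (simp_all add: separated_meixner_root meixner_root_balanced)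
  fix i assume "i \<in> {1..n}" "meixner_root n \<beta>' c' i \<le> meixner_root n \<beta> c i"
  then show "meixner_force \<beta> c (meixner_root n \<beta> c i) < meixner_force \<beta>' c' (meixner_root n \<beta>' c' i)"
    using assms \<open>0 < \<beta>'\<close> \<open>0 < c'\<close> meixner_root_zero[of \<beta>' c' i n]
    by (intro meixner_force_less) auto
qed fact

section \<open>Convexity of the energy and the unique minimizer\<close>

text \<open>Mean value theorem between the two points, with strictly increasing derivative. The
  half-line starts at 1 for the pair potential and at 0 for the field.\<close>

lemma above_tangent:
  fixes f f' :: "real \<Rightarrow> real"
  assumes deriv: "\<And>t. a < t \<Longrightarrow> (f has_real_derivative f' t) (at t)"
    and mono: "\<And>s t. a < s \<Longrightarrow> s < t \<Longrightarrow> f' s < f' t"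
    and "a < x" "a < y" "x \<noteq> y"
  shows "f x + f' x * (y - x) < f y"
proof (cases "x < y")
  case True
  then obtain z where "x < z" "z < y" "f y - f x = (y - x) * f' z"
    using MVT2[of x y f f'] deriv assms by auto
  moreover from this have "(y - x) * f' x < (y - x) * f' z"
    using True mono assms by simp
  ultimately show ?thesis by (simp add: algebra_simps)
next
  case False
  then have "y < x" using assms by simp
  then obtain z where "y < z" "z < x" "f x - f y = (x - y) * f' z"
    using MVT2[of y x f f'] deriv assms by auto
  moreover from this have "(x - y) * f' z < (x - y) * f' x"
    using \<open>y < x\<close> mono assms by simp
  ultimately show ?thesis by (simp add: algebra_simps)
qed

lemma charge_potential_commute:
  assumes "\<bar>y - x\<bar> > 1"
  shows "charge_potential x y = charge_potential y x"
proof -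
  have eq: "(x - y + 1) / (x - y - 1) = inverse ((y - x + 1) / (y - x - 1))"
    using assms by (simp add: field_simps)
  have "ln ((x - y + 1) / (x - y - 1)) = - ln ((y - x + 1) / (y - x - 1))"
    unfolding eq by (simp only: ln_inverse)
  moreover have "(x - y + 1) * (x - y - 1) = (y - x + 1) * (y - x - 1)"
    by (simp add: algebra_simps)
  moreover have "(y - x) / 2 * - L = (x - y) / 2 * L" for L :: real
    by (simp add: field_simps)
  ultimately show ?thesis unfolding charge_potential_def by (simp only:)
qed

lemma charge_potential_above_tangent:
  assumes "1 < d" "1 < e"
  shows "charge_potential 0 d - pair_force d * (e - d) \<le> charge_potential 0 e"
proof (cases "d = e")
  case False
  \<comment> \<open>The potential with its logarithms split and collected; on differentiation the
    constants from the two products cancel.\<close>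
  define g where "g t = - ((t + 1) * ln (t + 1) - (t - 1) * ln (t - 1)) / 2" for t :: real
  have eq: "charge_potential 0 t = g t" if "1 < t" for t
  proof -
    have "ln ((t + 1) / (t - 1)) = ln (t + 1) - ln (t - 1)"
      "ln ((t + 1) * (t - 1)) = ln (t + 1) + ln (t - 1)"
      using that by (simp_all add: ln_div ln_mult)
    then show ?thesis
      unfolding charge_potential_def g_def diff_zero by (simp only:) (simp add: field_simps)
  qed
  have "(g has_real_derivative - pair_force t) (at t)" if "1 < t" for t
    unfolding g_def pair_force_def
    by (rule derivative_eq_intros refl | use that in \<open>simp add: ln_div field_simps\<close>)+
  then have "g d + - pair_force d * (e - d) < g e"
    using assms False by (intro above_tangent[where a = 1]) (auto intro: pair_force_less)
  then show ?thesis using assms by (simp add: eq)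
qed simp

text \<open>For k < j both differences exceed 1 and translation reduces to the previous bound; the
  other order follows because the potential is symmetric and the force odd.\<close>

lemma charge_potential_pair_above_tangent:
  assumes "separated n x" "separated n y" "j \<in> {1..n}" "k \<in> {1..n}" "j \<noteq> k"
  shows "charge_potential (x k) (x j) - pair_force (x j - x k) * ((y j - x j) - (y k - x k))
           \<le> charge_potential (y k) (y j)"
proof -
  have tr: "charge_potential s t = charge_potential 0 (t - s)" for s t
    by (simp add: charge_potential_def)
  have *: "charge_potential (x k) (x j) - pair_force (x j - x k) * ((y j - x j) - (y k - x k))
           \<le> charge_potential (y k) (y j)" if "k < j" "j \<in> {1..n}" "k \<in> {1..n}" for j k
    using charge_potential_above_tangent[of "x j - x k" "y j - y k"] that assms(1,2)
    unfolding tr[of "x k"] tr[of "y k"] separated_def by (force simp: algebra_simps)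
  show ?thesis
  proof (cases "k < j")
    case False
    have d: "\<bar>x j - x k\<bar> > 1" "\<bar>y j - y k\<bar> > 1"
      using assms by (auto intro: separated_dist)
    then have "pair_force (x k - x j) = - pair_force (x j - x k)"
      using pair_force_uminus[of "x j - x k"] by simp
    then show ?thesis
      using *[of j k] False assms d charge_potential_commute[of "x j" "x k"]
        charge_potential_commute[of "y j" "y k"]
      by (simp add: algebra_simps)
  qed (use * assms in auto)
qed

lemma energy_eq:
  "energy n \<phi> x = (\<Sum>j\<in>{1..n}. \<Sum>k\<in>{1..n}-{j}. charge_potential (x k) (x j))
                   + 2 * (\<Sum>j\<in>{1..n}. \<phi> (x j))"
proof -
  have "{(j, k). j \<in> {1..n} \<and> k \<in> {1..n} \<and> j \<noteq> k} = (SIGMA j:{1..n}. {1..n}-{j})" by auto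
  then show ?thesis by (simp add: energy_def sum.Sigma)
qed

text \<open>Rewritten as sums over the set of positions, the energy is visibly unchanged when a
  competitor is sorted.\<close>

lemma energy_image:
  assumes "inj_on x {1..n}"
  shows "energy n \<phi> x = (\<Sum>a\<in>x`{1..n}. \<Sum>b\<in>x`{1..n}-{a}. charge_potential b a)
                          + 2 * (\<Sum>a\<in>x`{1..n}. \<phi> a)"
proof -
  have "(\<Sum>k\<in>{1..n}-{j}. charge_potential (x k) (x j))
          = (\<Sum>b\<in>x`{1..n}-{x j}. charge_potential b (x j))" if "j \<in> {1..n}" for j
  proof -
    have "x`{1..n} - {x j} = x ` ({1..n} - {j})"
      using inj_on_image_set_diff[OF assms, of "{1..n}" "{j}"] that by auto
    moreover have "inj_on x ({1..n} - {j})" using assms by (rule inj_on_subset) auto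
    ultimately show ?thesis by (simp add: sum.reindex)
  qed
  then show ?thesis unfolding energy_eq using assms by (simp add: sum.reindex)
qed

text \<open>Summing the tangent bounds leaves linear terms in the displacements \<open>h\<close>.
  Oddness of the force turns the pair part into twice the total repulsion times \<open>h\<close>,
  and balance cancels it against the doubled field part. Strictness comes from the field, as a
  common translation leaves the pair terms unchanged.\<close>

lemma balanced_energy_less:
  assumes F: "field_with_force {0<..} F \<phi>" "\<And>s t. 0 < s \<Longrightarrow> s < t \<Longrightarrow> F t < F s"
    and x: "separated n x" "balanced n F x" "\<And>j. j \<in> {1..n} \<Longrightarrow> 0 < x j"
    and y: "separated n y" "\<And>j. j \<in> {1..n} \<Longrightarrow> 0 < y j"
    and neq: "i \<in> {1..n}" "y i \<noteq> x i"
  shows "energy n \<phi> x < energy n \<phi> y"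
proof -
  define I where "I = {1..n}"
  define h where "h j = y j - x j" for j
  define f where "f j k = pair_force (x j - x k)" for j k
  have field_less: "\<phi> (x j) - F (x j) * h j < \<phi> (y j)" if "j \<in> I" "y j \<noteq> x j" for j
    using above_tangent[of 0 \<phi> "\<lambda>t. - F t" "x j" "y j"] that x(3) y(2) F
    by (auto simp: field_with_force_def I_def h_def)
  then have field_le: "\<phi> (x j) - F (x j) * h j \<le> \<phi> (y j)" if "j \<in> I" for j
    using that by (cases "y j = x j") (auto simp: h_def less_imp_le)
  have "(\<Sum>j\<in>I. \<phi> (x j) - F (x j) * h j) < (\<Sum>j\<in>I. \<phi> (y j))"
  proof (rule sum_strict_mono_ex1)
    show "\<exists>j\<in>I. \<phi> (x j) - F (x j) * h j < \<phi> (y j)"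
      using field_less[of i] neq by (auto simp: I_def)
  qed (use field_le in \<open>auto simp: I_def\<close>)
  then have A: "(\<Sum>j\<in>I. \<phi> (x j)) - (\<Sum>j\<in>I. F (x j) * h j) < (\<Sum>j\<in>I. \<phi> (y j))"
    by (simp add: sum_subtractf)
  have "(\<Sum>j\<in>I. \<Sum>k\<in>I-{j}. charge_potential (x k) (x j) - f j k * (h j - h k))
          \<le> (\<Sum>j\<in>I. \<Sum>k\<in>I-{j}. charge_potential (y k) (y j))"
    using charge_potential_pair_above_tangent[OF x(1) y(1)]
    by (intro sum_mono) (auto simp: I_def f_def h_def)
  then have B: "(\<Sum>j\<in>I. \<Sum>k\<in>I-{j}. charge_potential (x k) (x j))
         - (\<Sum>j\<in>I. \<Sum>k\<in>I-{j}. f j k * (h j - h k))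
          \<le> (\<Sum>j\<in>I. \<Sum>k\<in>I-{j}. charge_potential (y k) (y j))"
    by (simp add: sum_subtractf)
  have "(\<Sum>j\<in>I. \<Sum>k\<in>I-{j}. f j k * h k) = (\<Sum>k\<in>I. \<Sum>j\<in>I-{k}. f j k * h k)"
  proof -
    have 1: "I - {j} = {k \<in> I. j \<noteq> k}" and 2: "I - {j} = {k \<in> I. k \<noteq> j}" for j by auto
    have "(\<Sum>j\<in>I. \<Sum>k\<in>{k \<in> I. j \<noteq> k}. f j k * h k) = (\<Sum>k\<in>I. \<Sum>j\<in>{j \<in> I. j \<noteq> k}. f j k * h k)"
      by (rule sum.swap_restrict) (auto simp: I_def)
    then show ?thesis unfolding 1[symmetric] 2[symmetric] .
  qed
  also have "\<dots> = - (\<Sum>k\<in>I. \<Sum>j\<in>I-{k}. f k j * h k)"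
    unfolding sum_negf[symmetric]
  proof (intro sum.cong refl)
    fix k j assume "k \<in> I" "j \<in> I - {k}"
    then have "\<bar>x k - x j\<bar> > 1" using x(1) by (auto simp: I_def intro!: separated_dist)
    from pair_force_uminus[OF this] show "f j k * h k = - (f k j * h k)" by (simp add: f_def)
  qed
  finally have "(\<Sum>j\<in>I. \<Sum>k\<in>I-{j}. f j k * (h j - h k)) = 2 * (\<Sum>j\<in>I. \<Sum>k\<in>I-{j}. f j k * h j)"
    by (simp add: right_diff_distrib sum_subtractf)
  also have "(\<Sum>j\<in>I. \<Sum>k\<in>I-{j}. f j k * h j) = (\<Sum>j\<in>I. - F (x j) * h j)"
  proof (rule sum.cong)
    fix j assume "j \<in> I"
    then have "(\<Sum>k\<in>I-{j}. f j k) = - F (x j)"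
      using x(2) by (auto simp: balanced_def I_def f_def add_eq_0_iff2)
    then show "(\<Sum>k\<in>I-{j}. f j k * h j) = - F (x j) * h j"
      by (simp flip: sum_distrib_right)
  qed simp
  also have "\<dots> = - (\<Sum>j\<in>I. F (x j) * h j)" by (simp add: sum_negf)
  finally show ?thesis using A B unfolding energy_eq I_def[symmetric] by simp
qed

lemma admissible_inj: "admissible n S y \<Longrightarrow> inj_on y {1..n}"
  unfolding admissible_def inj_on_def by fastforce

text \<open>Sorting makes the distinct positions increasing, and admissibility widens each step
  beyond 1. Arbitrary competitors thus reduce to separated ones.\<close>

lemma admissible_sorted:
  assumes "admissible n S y"
  obtains y' where "separated n y'" "y' ` {1..n} = y ` {1..n}"
proof
  define Y where "Y = y ` {1..n}"
  define y' where "y' j = sorted_list_of_set Y ! (j - 1)" for j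
  have Y: "finite Y" "card Y = n"
    using admissible_inj[OF assms] by (auto simp: Y_def card_image)
  have dist: "\<bar>a - b\<bar> > 1" if "a \<in> Y" "b \<in> Y" "a \<noteq> b" for a b
    using that assms by (auto simp: Y_def admissible_def)
  have mem: "y' j \<in> Y" if "j \<in> {1..n}" for j
    using that Y nth_mem[of "j - 1" "sorted_list_of_set Y"] by (auto simp: y'_def)
  show "separated n y'"
  proof (rule separatedI)
    fix j assume j: "1 \<le> j" "j < n"
    then have "y' j < y' (Suc j)"
      using sorted_wrt_nth_less[OF strict_sorted_list_of_set[of Y], of "j - 1" j] Y
      by (simp add: y'_def)
    then show "y' j + 1 < y' (Suc j)"
      using dist[of "y' j" "y' (Suc j)"] mem[of j] mem[of "Suc j"] j by auto
  qed
  then have "inj_on y' {1..n}" by (rule separated_inj)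
  then show "y' ` {1..n} = y ` {1..n}"
    unfolding Y_def[symmetric] using mem Y
    by (intro card_subset_eq) (auto simp: card_image)
qed

text \<open>A competitor is sorted without changing its energy and then compared with
  \<open>x\<close>. An equilibrium is already separated, so if it differed from \<open>x\<close> the
  strict inequality would contradict its minimality.\<close>

lemma equilibrium_if_balanced:
  assumes F: "field_with_force {0<..} F \<phi>" "\<And>s t. 0 < s \<Longrightarrow> s < t \<Longrightarrow> F t < F s"
    and x: "separated n x" "balanced n F x" "\<And>j. j \<in> {1..n} \<Longrightarrow> 0 < x j"
  shows "equilibrium n {0<..} \<phi> x"
    and "equilibrium n {0<..} \<phi> y \<Longrightarrow> j \<in> {1..n} \<Longrightarrow> y j = x j"
proof -
  have adm: "admissible n {0<..} x"
    using x separated_dist[OF x(1)] by (auto simp: admissible_def)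
  have "energy n \<phi> x \<le> energy n \<phi> y" if adm_y: "admissible n {0<..} y" for y
  proof -
    obtain y' where y': "separated n y'" "y' ` {1..n} = y ` {1..n}"
      using admissible_sorted[OF adm_y] .
    have eq: "energy n \<phi> y = energy n \<phi> y'"
      using admissible_inj[OF adm_y] separated_inj[OF y'(1)] y'(2) by (simp add: energy_image)
    have pos: "0 < y' j" if "j \<in> {1..n}" for j
    proof -
      have "y' j \<in> y ` {1..n}" using y'(2) that by blast
      then show ?thesis using adm_y by (auto simp: admissible_def)
    qed
    show ?thesis
    proof (cases "\<forall>j\<in>{1..n}. y' j = x j")
      case True
      then have "energy n \<phi> y' = energy n \<phi> x" by (simp add: energy_eq)
      then show ?thesis by (simp add: eq)
    next
      case False
      then show ?thesis using balanced_energy_less[OF F x y'(1) pos] by (auto simp: eq less_imp_le)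
    qed
  qed
  with adm show "equilibrium n {0<..} \<phi> x"
    using x(1) by (auto simp: equilibrium_def separated_def)
  assume y: "equilibrium n {0<..} \<phi> y" and j: "j \<in> {1..n}"
  then have "separated n y" by (intro separatedI) (auto simp: equilibrium_def)
  moreover have "0 < y i" if "i \<in> {1..n}" for i
    using y that by (auto simp: equilibrium_def admissible_def)
  ultimately show "y j = x j"
    using balanced_energy_less[OF F x _ _ j, of y] y adm by (force simp: equilibrium_def)
qed

theorem mainTheorem9:
  fixes n :: nat and \<beta> c :: real
  assumes "n \<ge> 1" and "\<beta> > 0" and "0 < c" and "c < 1"
  shows "({z :: complex. poly (meixner n (of_real \<beta>) (of_real c)) z = 0} =
           of_real ` meixner_root n \<beta> c ` {1..n}) \<and>
         (\<forall>z :: complex. poly (meixner n (of_real \<beta>) (of_real c)) z = 0 \<longrightarrow>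
           order z (meixner n (of_real \<beta>) (of_real c)) = 1) \<and>
         (strict_mono_on {1..n} (meixner_root n \<beta> c)) \<and>
         (\<forall>j\<in>{1..n}. meixner_root n \<beta> c j > 0) \<and>
         (\<forall>j\<in>{1..n}. \<forall>k\<in>{1..n}. j \<noteq> k \<longrightarrow>
           \<bar>meixner_root n \<beta> c j - meixner_root n \<beta> c k\<bar> > 1) \<and>
         (\<forall>\<phi>. field_with_force {0<..} (meixner_force \<beta> c) \<phi> \<longrightarrow>
           equilibrium n {0<..} \<phi> (meixner_root n \<beta> c) \<and>
           (\<forall>y. equilibrium n {0<..} \<phi> y \<longrightarrow> (\<forall>j\<in>{1..n}. y j = meixner_root n \<beta> c j))) \<and>
         (\<forall>j\<in>{1..n}. \<forall>\<beta>'. \<beta> < \<beta>' \<longrightarrow> meixner_root n \<beta> c j < meixner_root n \<beta>' c j) \<and>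
         (\<forall>j\<in>{1..n}. \<forall>c'. c < c' \<and> c' < 1 \<longrightarrow> meixner_root n \<beta> c j < meixner_root n \<beta> c' j)"
proof -
  note params = assms(2-4)
  note sep = separated_meixner_root[OF params, of n]
  have force: "meixner_force \<beta> c t < meixner_force \<beta> c s" if "0 < s" "s < t" for s t
    using that params by (intro meixner_force_less) auto
  have pos: "0 < meixner_root n \<beta> c j" if "j \<in> {1..n}" for j
    using meixner_root_zero[OF params that] by simp
  have equ: "equilibrium n {0<..} \<phi> (meixner_root n \<beta> c)"
    "equilibrium n {0<..} \<phi> y \<Longrightarrow> j \<in> {1..n} \<Longrightarrow> y j = meixner_root n \<beta> c j"
    if "field_with_force {0<..} (meixner_force \<beta> c) \<phi>" for \<phi> y j
    using equilibrium_if_balanced[OF that force sep meixner_root_balanced[OF params] pos] by blast+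
  have less_\<beta>: "meixner_root n \<beta> c j < meixner_root n \<beta>' c j" if "j \<in> {1..n}" "\<beta> < \<beta>'" for j \<beta>'
    using that params by (intro meixner_root_less) auto
  have less_c: "meixner_root n \<beta> c j < meixner_root n \<beta> c' j" if "j \<in> {1..n}" "c < c'" "c' < 1" for j c'
    using that params by (intro meixner_root_less) auto
  show ?thesis
  proof (intro conjI)
    show "strict_mono_on {1..n} (meixner_root n \<beta> c)" using sep by (rule separated_strict_mono)
    show "\<forall>j\<in>{1..n}. \<forall>k\<in>{1..n}. j \<noteq> k \<longrightarrow> \<bar>meixner_root n \<beta> c j - meixner_root n \<beta> c k\<bar> > 1"
      using separated_dist[OF sep] by blast
    show "\<forall>\<phi>. field_with_force {0<..} (meixner_force \<beta> c) \<phi> \<longrightarrow>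
        equilibrium n {0<..} \<phi> (meixner_root n \<beta> c) \<and>
        (\<forall>y. equilibrium n {0<..} \<phi> y \<longrightarrow> (\<forall>j\<in>{1..n}. y j = meixner_root n \<beta> c j))"
      using equ by blast
  qed (use meixner_complex_zeros[OF params] pos less_\<beta> less_c in blast)+
qed

end
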